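(* Let $a,b,c,d\ge0$ be real numbers. The matrix $\begin{pmatrix}a&b\\c&d\end{pmatrix}$ is the dominance matrix $D(M)$ of some $3\times3$ monotone matrix $M$ if and only if there exist $m_{11},m_{33}\in[0,1]$ such that $$\begin{cases} a+c\le m_{11},\\ b+d\le m_{33},\\ m_{11}+m_{33}\le1+b+d,\\ m_{11}+m_{33}\le1+a+d,\\ m_{11}+m_{33}\le1+a+c.\end{cases}$$
   Context: A stochastic matrix is a (real) entrywise non-negative square matrix each of whose row sums equals $1$. An $n\times n$ monotone matrix is an $n\times n$ stochastic matrix $M=(m_{ij})$ such that $\sum_{j=r}^n m_{lj}\ge\sum_{j=r}^n m_{kj}$ for all $l>k$ in $\{1,\dots,n\}$ and all $r\in\{1,\dots,n\}$. The dominance matrix of an $n\times n$ monotone matrix $M$ is the $(n-1)\times(n-1)$ matrix $D(M)$ with entries $(D(M))_{kl}=\sum_{j=1}^l m_{kj}-\sum_{j=1}^l m_{k+1,j}$ for $k,l\in\{1,\dots,n-1\}$. *)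

theory Defs
  imports Complex_Main "Jordan_Normal_Form.Matrix"
begin

text \<open>Matrix indices start at 0, so the mathematical entry \<open>m\<^sub>i\<^sub>j\<close> is \<open>M $$ (i - 1, j - 1)\<close>.\<close>

definition stochastic_mat :: "real mat \<Rightarrow> bool" where
  "stochastic_mat M \<longleftrightarrow> square_mat M \<and>
     (\<forall>i < dim_row M. \<forall>j < dim_col M. 0 \<le> M $$ (i, j)) \<and>
     (\<forall>i < dim_row M. (\<Sum>j < dim_col M. M $$ (i, j)) = 1)"

definition monotone_mat :: "real mat \<Rightarrow> bool" where
  "monotone_mat M \<longleftrightarrow> stochastic_mat M \<and>
     (\<forall>k < dim_row M. \<forall>l < dim_row M. \<forall>r < dim_row M. k < l \<longrightarrow>
        (\<Sum>j = r..<dim_row M. M $$ (k, j)) \<le> (\<Sum>j = r..<dim_row M. M $$ (l, j)))"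

text \<open>The sums over \<open>j = 1, \<dots>, l\<close> become sums over \<open>{..l}\<close> because \<open>l\<close> is shifted as well.\<close>

definition dominance_mat :: "real mat \<Rightarrow> real mat" where
  "dominance_mat M = mat (dim_row M - 1) (dim_row M - 1)
     (\<lambda>(k, l). (\<Sum>j\<le>l. M $$ (k, j)) - (\<Sum>j\<le>l. M $$ (k + 1, j)))"

end

theory Submission
  imports Defs
begin

text \<open>
  A stochastic \<open>3 \<times> 3\<close> matrix is determined by its dominance matrix together with \<open>m\<^sub>1\<^sub>1\<close> and
  \<open>m\<^sub>3\<^sub>3\<close>: the partial row sums \<open>m\<^sub>k\<^sub>1\<close> follow from \<open>m\<^sub>1\<^sub>1\<close> going downwards, and the sums
  \<open>m\<^sub>k\<^sub>1 + m\<^sub>k\<^sub>2 = 1 - m\<^sub>k\<^sub>3\<close> follow from \<open>m\<^sub>3\<^sub>3\<close> going upwards. The five inequalities are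
  the nonnegativity of the entries \<open>m\<^sub>3\<^sub>1\<close>, \<open>m\<^sub>1\<^sub>3\<close>, \<open>m\<^sub>1\<^sub>2\<close>, \<open>m\<^sub>2\<^sub>2\<close>, \<open>m\<^sub>3\<^sub>2\<close>;
  the remaining entries are then nonnegative as well.
\<close>

lemma all_less_2_iff: "(\<forall>i<2. P i) \<longleftrightarrow> P 0 \<and> P (1::nat)"
  by (auto simp: less_2_cases_iff)

lemma all_less_3_iff: "(\<forall>i<3. P i) \<longleftrightarrow> P 0 \<and> P 1 \<and> P (2::nat)"
  by (auto simp: numeral_3_eq_3 numeral_2_eq_2 less_Suc_eq)

lemma stochastic_mat_3_iff:
  assumes "M \<in> carrier_mat 3 3"
  shows "stochastic_mat M \<longleftrightarrow>
    (\<forall>i<3. 0 \<le> M $$ (i, 0) \<and> 0 \<le> M $$ (i, 1) \<and> 0 \<le> M $$ (i, 2) \<and>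
           M $$ (i, 0) + M $$ (i, 1) + M $$ (i, 2) = 1)"
proof -
  have sums: "(\<Sum>j<3. M $$ (i, j)) = M $$ (i, 0) + M $$ (i, 1) + M $$ (i, 2)" for i
    by (simp add: numeral_3_eq_3 numeral_2_eq_2)
  have dim: "dim_row M = 3" "dim_col M = 3"
    using assms by simp_all
  show ?thesis
    unfolding stochastic_mat_def square_mat.simps dim sums all_less_3_iff by auto
qed

lemma dominance_mat_3_eq_iff:
  assumes "M \<in> carrier_mat 3 3"
  shows "dominance_mat M = mat_of_rows_list 2 [[a, b], [c, d]] \<longleftrightarrow>
    M $$ (0, 0) - M $$ (1, 0) = a \<and>
    M $$ (0, 0) + M $$ (0, 1) - (M $$ (1, 0) + M $$ (1, 1)) = b \<and>
    M $$ (1, 0) - M $$ (2, 0) = c \<and>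
    M $$ (1, 0) + M $$ (1, 1) - (M $$ (2, 0) + M $$ (2, 1)) = d"
proof -
  have "dominance_mat M = mat_of_rows_list 2 [[a, b], [c, d]] \<longleftrightarrow>
    (\<forall>i<2. \<forall>j<2. dominance_mat M $$ (i, j) = [[a, b], [c, d]] ! i ! j)"
    using assms by (auto simp: mat_eq_iff dominance_mat_def mat_of_rows_list_def)
  then show ?thesis
    using assms by (simp add: all_less_2_iff dominance_mat_def flip: numeral_2_eq_2)
qed

text \<open>Rows sum to 1, so tails from column 0 agree, and comparing tails from column 1 reverses
  the comparison of first entries. By transitivity adjacent rows suffice.\<close>

lemma monotone_mat_3_iff:
  assumes "M \<in> carrier_mat 3 3"
  shows "monotone_mat M \<longleftrightarrow> stochastic_mat M \<and>
    M $$ (0, 0) \<ge> M $$ (1, 0) \<and> M $$ (1, 0) \<ge> M $$ (2, 0) \<and>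
    M $$ (0, 2) \<le> M $$ (1, 2) \<and> M $$ (1, 2) \<le> M $$ (2, 2)"
proof -
  have sums: "(\<Sum>j = 0..<3. M $$ (i, j)) = M $$ (i, 0) + M $$ (i, 1) + M $$ (i, 2)"
    "(\<Sum>j = 1..<3. M $$ (i, j)) = M $$ (i, 1) + M $$ (i, 2)"
    "(\<Sum>j = 2..<3. M $$ (i, j)) = M $$ (i, 2)" for i
    by (simp_all add: numeral_3_eq_3 numeral_2_eq_2)
  have dim: "dim_row M = 3"
    using assms by simp
  show ?thesis
    unfolding monotone_mat_def stochastic_mat_3_iff[OF assms] dim all_less_3_iff sums by auto
qed

theorem lemma2p2:
  fixes a b c d :: real
  assumes "a \<ge> 0" and "b \<ge> 0" and "c \<ge> 0" and "d \<ge> 0"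
  shows "(\<exists>M \<in> carrier_mat 3 3. monotone_mat M \<and>
            dominance_mat M = mat_of_rows_list 2 [[a, b], [c, d]]) \<longleftrightarrow>
         (\<exists>m11 \<in> {0..1}. \<exists>m33 \<in> {0..1}.
            a + c \<le> m11 \<and>
            b + d \<le> m33 \<and>
            m11 + m33 \<le> 1 + b + d \<and>
            m11 + m33 \<le> 1 + a + d \<and>
            m11 + m33 \<le> 1 + a + c)"
    (is "?L \<longleftrightarrow> ?R")
proof
  assume ?L
  then obtain M where M: "M \<in> carrier_mat 3 3" "monotone_mat M"
    "dominance_mat M = mat_of_rows_list 2 [[a, b], [c, d]]"
    by blast
  have "stochastic_mat M"
    using M(2) by (simp add: monotone_mat_def)
  note facts = this[unfolded stochastic_mat_3_iff[OF M(1)] all_less_3_iff]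
    M(3)[unfolded dominance_mat_3_eq_iff[OF M(1)]]
  show ?R
    by (rule bexI[of _ "M $$ (0, 0)"], rule bexI[of _ "M $$ (2, 2)"]) (use facts in auto)
next
  assume ?R
  then obtain m11 m33 where m: "0 \<le> m11" "0 \<le> m33" "a + c \<le> m11" "b + d \<le> m33"
    "m11 + m33 \<le> 1 + b + d" "m11 + m33 \<le> 1 + a + d" "m11 + m33 \<le> 1 + a + c"
    by auto
  \<comment> \<open>The outer columns come from \<open>m11\<close> and \<open>m33\<close> by
    successive subtraction; the middle column completes each row sum to 1.\<close>
  define M where "M = mat_of_rows_list 3
    [[m11, 1 + b + d - m11 - m33, m33 - b - d],
     [m11 - a, 1 + a + d - m11 - m33, m33 - d],
     [m11 - a - c, 1 + a + c - m11 - m33, m33]]"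
  have M: "M \<in> carrier_mat 3 3"
    by (simp add: M_def mat_of_rows_list_def numeral_3_eq_3)
  have entries:
    "M $$ (0, 0) = m11" "M $$ (0, 1) = 1 + b + d - m11 - m33" "M $$ (0, 2) = m33 - b - d"
    "M $$ (1, 0) = m11 - a" "M $$ (1, 1) = 1 + a + d - m11 - m33" "M $$ (1, 2) = m33 - d"
    "M $$ (2, 0) = m11 - a - c" "M $$ (2, 1) = 1 + a + c - m11 - m33" "M $$ (2, 2) = m33"
    by (simp_all add: M_def mat_of_rows_list_def)
  \<comment> \<open>Going down, the first column drops by \<open>a\<close>, \<open>c\<close> and the
    last rises by \<open>b\<close>, \<open>d\<close>. Hence entries (1, 0) and (1, 2) exceed the
    nonnegative (2, 0) and (0, 2) by \<open>c\<close> and \<open>b\<close>.\<close>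
  have "monotone_mat M"
    unfolding monotone_mat_3_iff[OF M] stochastic_mat_3_iff[OF M] all_less_3_iff entries
    using m assms by auto
  moreover have "dominance_mat M = mat_of_rows_list 2 [[a, b], [c, d]]"
    unfolding dominance_mat_3_eq_iff[OF M] entries by simp
  ultimately show ?L
    using M by blast
qed

end
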